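(* Let $G$ be a finite, simple, undirected graph and let $Q\subseteq V(G)$ be a 3-covering of $G$. Let $uv\in E(G)$ be an edge with $u\notin Q$, $v\notin Q$, and such that neither $u$ nor $v$ is a pendant vertex. Then there exist vertices $x,w\in Q$, with $x,w\notin\{u,v\}$, $xu\in E(G)$ and $vw\in E(G)$; thus either $x\neq w$ and $x,u,v,w$ is a path on 4 vertices whose two end vertices lie in $Q$, or $x=w$ and $x,u,v$ form a triangle with $x\in Q$. Moreover, if $uv$ and $u'v'$ are two edges each of which satisfies the hypotheses above (both endpoints outside $Q$ and neither endpoint pendant), then either they have no vertex in common or $\{u,v\}=\{u',v'\}$.
   Context: A path on 3 vertices (a 3-path) is a sequence $a,b,c$ of three distinct vertices with $ab,bc\in E(G)$. A 3-covering of $G$ is a set $Q$ of vertices such that every 3-path of $G$ contains at least one vertex of $Q$. A pendant vertex is a vertex of degree $1$. *)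

theory Defs
  imports "Graph_Theory.Graph_Theory"
begin

text \<open>A finite simple undirected graph is a finite loop-free symmetric digraph without
  parallel arcs (locale \<^locale>\<open>graph\<close>): the undirected edge between \<open>u\<close> and \<open>v\<close> is the pair of
  opposite arcs, so \<open>u \<rightarrow>\<^bsub>G\<^esub> v\<close> says that \<open>u\<close> and \<open>v\<close> are adjacent, and the degree of a vertex
  is its out-degree.\<close>

definition k_path :: "('a, 'b) pre_digraph \<Rightarrow> nat \<Rightarrow> 'a list \<Rightarrow> bool" where
  "k_path G k p \<longleftrightarrow> vpath p G \<and> length p = k"

definition three_covering :: "('a, 'b) pre_digraph \<Rightarrow> 'a set \<Rightarrow> bool" where
  "three_covering G Q \<longleftrightarrow> Q \<subseteq> verts G \<and> (\<forall>p. k_path G 3 p \<longrightarrow> set p \<inter> Q \<noteq> {})"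

definition pendant :: "('a, 'b) pre_digraph \<Rightarrow> 'a \<Rightarrow> bool" where
  "pendant G v \<longleftrightarrow> v \<in> verts G \<and> out_degree G v = 1"

definition triangle :: "('a, 'b) pre_digraph \<Rightarrow> 'a \<Rightarrow> 'a \<Rightarrow> 'a \<Rightarrow> bool" where
  "triangle G a b c \<longleftrightarrow> distinct [a, b, c] \<and> a \<rightarrow>\<^bsub>G\<^esub> b \<and> b \<rightarrow>\<^bsub>G\<^esub> c \<and> c \<rightarrow>\<^bsub>G\<^esub> a"

definition uncovered_nonpendant_edge ::
    "('a, 'b) pre_digraph \<Rightarrow> 'a set \<Rightarrow> 'a \<Rightarrow> 'a \<Rightarrow> bool" where
  "uncovered_nonpendant_edge G Q u v \<longleftrightarrow>
     u \<rightarrow>\<^bsub>G\<^esub> v \<and> u \<notin> Q \<and> v \<notin> Q \<and> \<not> pendant G u \<and> \<not> pendant G v"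

end

theory Submission
  imports Defs
begin

text \<open>If \<open>u\<close> and \<open>v\<close> are adjacent and both lie outside
  \<open>Q\<close>, any neighbour \<open>x\<close> of \<open>u\<close> other than \<open>v\<close>
  gives a 3-path \<open>x, u, v\<close> that only \<open>x\<close> can cover, so \<open>x\<close> is
  in \<open>Q\<close> (\<open>uncovered_edge_other_neighbour\<close>). As neither end is pendant,
  each has a neighbour besides the other end (\<open>other_out_neighbour\<close>); these two
  vertices are the required \<open>x\<close> and \<open>w\<close>, and whether they coincide decides
  between triangle and path. The same fact makes \<open>v\<close> the only neighbour of
  \<open>u\<close> outside \<open>Q\<close>, so two such edges cannot share exactly one
  vertex.\<close>

lemma (in nomulti_digraph) other_out_neighbour:
  assumes "u \<rightarrow> v" and "\<not> pendant G u"
  obtains x where "u \<rightarrow> x" "x \<noteq> v"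
proof -
  from assms(1) obtain e where e: "e \<in> arcs G" "tail G e = u" "head G e = v"
    by (rule reachableE)
  \<comment> \<open>Otherwise \<open>u\<close> would have out-degree 1 and be pendant.\<close>
  have "out_arcs G u \<noteq> {e}"
    using assms adj_in_verts(1) by (auto simp: pendant_def out_degree_def)
  then obtain f where f: "f \<in> arcs G" "tail G f = u" "f \<noteq> e"
    using e unfolding out_arcs_def by blast
  \<comment> \<open>Distinct arcs with the same tail have distinct heads, since there are no
    parallel arcs.\<close>
  have "head G f \<noteq> v"
    using no_multi_arcs[of f e] e f by (auto simp: arc_to_ends_def)
  moreover have "u \<rightarrow> head G f"
    using f by (intro dominatesI[of f]) (simp_all add: arc_to_ends_def)
  ultimately show thesis by (rule that[rotated])
qed

lemma (in graph) adj_sym: "u \<rightarrow> v \<Longrightarrow> v \<rightarrow> u"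
  using sym_arcs by (rule arcs_ends_symmetric)

lemma (in graph) three_coveringD:
  assumes "three_covering G Q" and "a \<rightarrow> b" "b \<rightarrow> c" "a \<noteq> c"
  shows "a \<in> Q \<or> b \<in> Q \<or> c \<in> Q"
proof -
  have "k_path G 3 [a, b, c]"
    using assms(2-4) adj_in_verts adj_not_same
    by (auto simp: k_path_def vpath_def vwalk_def)
  then show ?thesis
    using assms(1) unfolding three_covering_def by fastforce
qed

text \<open>The covering must meet the 3-path \<open>x, u, v\<close>, and \<open>x\<close> is the
  only vertex left for it.\<close>

lemma (in graph) uncovered_edge_other_neighbour:
  assumes "three_covering G Q" and "u \<rightarrow> v" "u \<notin> Q" "v \<notin> Q" and "u \<rightarrow> x" "x \<noteq> v"
  shows "x \<in> Q"
  using three_coveringD[of Q x u v] assms adj_sym by blast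

lemma uncovered_nonpendant_edge_commute:
  assumes "graph G"
  shows "uncovered_nonpendant_edge G Q u v \<longleftrightarrow> uncovered_nonpendant_edge G Q v u"
  using graph.adj_sym[OF assms] by (auto simp: uncovered_nonpendant_edge_def)

theorem theorem3:
  fixes G :: "('a, 'b) pre_digraph" and Q :: "'a set"
  assumes "graph G"
    and "three_covering G Q"
  shows "(\<forall>u v. uncovered_nonpendant_edge G Q u v \<longrightarrow>
           (\<exists>x w. x \<in> Q \<and> w \<in> Q \<and> x \<notin> {u, v} \<and> w \<notin> {u, v} \<and>
              x \<rightarrow>\<^bsub>G\<^esub> u \<and> v \<rightarrow>\<^bsub>G\<^esub> w \<and>
              ((x \<noteq> w \<and> k_path G 4 [x, u, v, w]) \<or> (x = w \<and> triangle G x u v)))) \<and>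
         (\<forall>u v u' v'. uncovered_nonpendant_edge G Q u v \<longrightarrow>
            uncovered_nonpendant_edge G Q u' v' \<longrightarrow>
            {u, v} \<inter> {u', v'} = {} \<or> {u, v} = {u', v'})"
proof -
  interpret graph G by (rule assms(1))
  note other_Q = uncovered_edge_other_neighbour[OF assms(2)]
  have "\<exists>x w. x \<in> Q \<and> w \<in> Q \<and> x \<notin> {u, v} \<and> w \<notin> {u, v} \<and>
      x \<rightarrow>\<^bsub>G\<^esub> u \<and> v \<rightarrow>\<^bsub>G\<^esub> w \<and>
      ((x \<noteq> w \<and> k_path G 4 [x, u, v, w]) \<or> (x = w \<and> triangle G x u v))"
    if "uncovered_nonpendant_edge G Q u v" for u v
  proof -
    from that have uv: "u \<rightarrow>\<^bsub>G\<^esub> v" "u \<notin> Q" "v \<notin> Q" and np: "\<not> pendant G u" "\<not> pendant G v"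
      by (auto simp: uncovered_nonpendant_edge_def)
    have vu: "v \<rightarrow>\<^bsub>G\<^esub> u" using uv(1) by (rule adj_sym)
    obtain x where x: "u \<rightarrow>\<^bsub>G\<^esub> x" "x \<noteq> v" using uv(1) np(1) by (rule other_out_neighbour)
    obtain w where w: "v \<rightarrow>\<^bsub>G\<^esub> w" "w \<noteq> u" using vu np(2) by (rule other_out_neighbour)
    have Q: "x \<in> Q" "w \<in> Q"
      using other_Q[OF uv x] other_Q[OF vu uv(3,2) w] by auto
    have xu: "x \<rightarrow>\<^bsub>G\<^esub> u" using x(1) by (rule adj_sym)
    have neq: "x \<noteq> u" "w \<noteq> v" "u \<noteq> v" using Q uv adj_not_same by auto
    \<comment> \<open>All other distinctness conditions of the path are already known, so
      \<open>x = w\<close> is the only obstruction.\<close>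
    have "k_path G 4 [x, u, v, w]" if "x \<noteq> w"
      using that neq x(2) w uv(1) xu adj_in_verts
      by (auto simp: k_path_def vpath_def vwalk_def)
    moreover have "triangle G x u v" if "x = w"
      using that neq x(2) w uv(1) xu by (auto simp: triangle_def)
    ultimately show ?thesis
      using Q neq x(2) w xu by blast
  qed
  moreover have "{u, v} \<inter> {u', v'} = {} \<or> {u, v} = {u', v'}"
    if edges: "uncovered_nonpendant_edge G Q u v" "uncovered_nonpendant_edge G Q u' v'" for u v u' v'
  proof -
    \<comment> \<open>If \<open>b\<close> and \<open>c\<close> differed, \<open>c\<close> would be
      another neighbour of \<open>a\<close> and hence in \<open>Q\<close>.\<close>
    have eq: "b = c"
      if "uncovered_nonpendant_edge G Q a b" "uncovered_nonpendant_edge G Q a c" for a b c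
      using that other_Q[of a b c] by (auto simp: uncovered_nonpendant_edge_def)
    \<comment> \<open>The common vertex may be either end of each edge; reversing edges brings it to
      the first position, where \<open>eq\<close> applies.\<close>
    note commute = uncovered_nonpendant_edge_commute[OF assms(1), THEN iffD1]
    show ?thesis
      using eq edges commute[OF edges(1)] commute[OF edges(2)] by blast
  qed
  ultimately show ?thesis by blast
qed

end
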